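(* For $n\ge 4$ the facets of $\mathsf{DP(n)}$ are exactly those given by the inequalities (i) $x_i\ge x_{i+1}$ for $i=1,\dots,n-1$; and (ii) $\sum_{i=1}^k x_i-\sum_{i=n-l+1}^n x_i\le k(n-1-l)$ for nonnegative integers $k,l$ with either $(k,l)=(1,0)$, or $(k,l)=(0,1)$, or $k,l\ge 1$ and $k+l\in\{2,3,\dots,n-3,n\}$. Consequently, for $n\ge 4$, $\mathsf{DP(n)}$ has $\frac{n(n-3)}{2}+6$ facets.
   Context: $\mathsf{DP(n)}\subseteq\mathbb{R}^n$ is the convex hull of all degree partitions (degree sequences sorted in weakly decreasing order, zeros allowed) of simple graphs on vertex set $[n]$. *)

theory Defs
  imports "HOL-Analysis.Analysis"
begin

definition simple_graph :: "nat \<Rightarrow> nat set set \<Rightarrow> bool" where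
  "simple_graph n E \<longleftrightarrow> (\<forall>e\<in>E. e \<subseteq> {1..n} \<and> card e = 2)"

definition vertex_degree :: "nat set set \<Rightarrow> nat \<Rightarrow> nat" where
  "vertex_degree E v = card {e \<in> E. v \<in> e}"

definition degree_partition :: "nat \<Rightarrow> nat set set \<Rightarrow> nat list" where
  "degree_partition n E = rev (sort (map (vertex_degree E) [1..<Suc n]))"

(* The ambient space of dimension n is real^'n, for a finite linearly ordered index type 'n
   with n elements.  The i-th coordinate x_i, for 1 \<le> i \<le> n, is the component of x at the
   i-th smallest element of 'n. *)
definition coord :: "real ^ 'n::{finite,linorder} \<Rightarrow> nat \<Rightarrow> real" where
  "coord x i = x $ (sorted_list_of_set (UNIV :: 'n set) ! (i - 1))"

definition DP :: "(real ^ 'n::{finite,linorder}) set" where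
  "DP = convex hull {x. \<exists>E. simple_graph CARD('n) E \<and>
          (\<forall>i\<in>{1..CARD('n)}. coord x i = real (degree_partition CARD('n) E ! (i - 1)))}"

definition KL :: "nat \<Rightarrow> (nat \<times> nat) set" where
  "KL n = {(k, l). (k, l) = (1, 0) \<or> (k, l) = (0, 1) \<or>
                   (k \<ge> 1 \<and> l \<ge> 1 \<and> k + l \<in> {2..n - 3} \<union> {n})}"

definition kl_lhs :: "nat \<Rightarrow> nat \<Rightarrow> real ^ 'n::{finite,linorder} \<Rightarrow> real" where
  "kl_lhs k l x = (\<Sum>i=1..k. coord x i) - (\<Sum>i=CARD('n) - l + 1..CARD('n). coord x i)"

definition kl_rhs :: "nat \<Rightarrow> nat \<Rightarrow> nat \<Rightarrow> real" where
  "kl_rhs n k l = real k * (real n - 1 - real l)"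

end

theory Submission
  imports Defs "HOL-Combinatorics.List_Permutation"
begin

text \<open>Let \<open>Q\<close> be the polyhedron cut out by the inequalities (i) and (ii). Counting edges gives
  \<open>DP \<subseteq> Q\<close>. The inequalities (ii) imply those for all \<open>k + l \<le> n\<close>. For \<open>Q \<subseteq> DP\<close>, separate a
  point \<open>x\<close> of \<open>Q\<close> from \<open>DP\<close> by an objective \<open>u\<close>, and project \<open>u\<close> to a vector \<open>c\<close> of the cone of
  decreasing vectors. Let \<open>d\<close> be the degree sequence of the threshold graph with edges \<open>{i, j}\<close> for
  \<open>c i + c j > 0\<close>. Integrating the inequality for the level sets \<open>{i. t < c i}\<close> and \<open>{i. t < - c i}\<close>
  over \<open>t \<ge> 0\<close> gives \<open>c \<bullet> x \<le> c \<bullet> d\<close>. By Moreau's decomposition, \<open>u \<bullet> x \<le> c \<bullet> x\<close>, and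
  \<open>c \<bullet> d \<le> u \<bullet> d\<close> because \<open>d\<close> is constant wherever \<open>c\<close> is; so \<open>u\<close> does not separate \<open>x\<close> from
  \<open>d\<close>. The system defining \<open>Q\<close> is strictly feasible and each of its inequalities is violated by a
  point satisfying all the others, so its members correspond bijectively to the facets.\<close>

section \<open>Irredundant systems of linear inequalities\<close>

text \<open>The strictly feasible \<open>z\<close> makes \<open>S\<close> full-dimensional, and each
  violator shows that its halfspace cannot be dropped. For injectivity, the segment from
  \<open>z\<close> to a violator of constraint \<open>i\<close> leaves \<open>S\<close> at a point
  where \<open>i\<close> alone is tight.\<close>

lemma
  fixes a :: "'i \<Rightarrow> 'a::euclidean_space"
  assumes "finite I"
    and S: "S = {x. \<forall>i\<in>I. a i \<bullet> x \<le> b i}"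
    and strict: "\<And>i. i \<in> I \<Longrightarrow> a i \<bullet> z < b i"
    and irredundant: "\<And>i. i \<in> I \<Longrightarrow> \<exists>w. b i < a i \<bullet> w \<and> (\<forall>j\<in>I - {i}. a j \<bullet> w \<le> b j)"
  shows facets_irredundant_system: "{F. F facet_of S} = (\<lambda>i. {x \<in> S. a i \<bullet> x = b i}) ` I"
    and inj_on_irredundant_system: "inj_on (\<lambda>i. {x \<in> S. a i \<bullet> x = b i}) I"
proof -
  define H where "H i = {x. a i \<bullet> x \<le> b i}" for i
  have injH: "inj_on H I"
  proof (rule inj_onI, rule ccontr)
    fix i j assume ij: "i \<in> I" "j \<in> I" "H i = H j" "i \<noteq> j"
    then obtain w where "b i < a i \<bullet> w" "a j \<bullet> w \<le> b j" using irredundant[of i] by auto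
    then have "w \<in> H j" "w \<notin> H i" by (auto simp: H_def)
    then show False using ij by simp
  qed
  define g where "g = inv_into I H"
  have g: "g (H i) = i" if "i \<in> I" for i unfolding g_def using injH that by simp
  have open_strict: "open (\<Inter>i\<in>I. {x. a i \<bullet> x < b i})"
    using \<open>finite I\<close> by (intro open_INT ballI open_halfspace_lt)
  have "(\<Inter>i\<in>I. {x. a i \<bullet> x < b i}) \<subseteq> S" unfolding S by (auto intro: less_imp_le)
  moreover have "z \<in> (\<Inter>i\<in>I. {x. a i \<bullet> x < b i})" using strict by auto
  ultimately have "z \<in> interior S" using open_strict by (rule_tac interiorI)
  then have "interior S \<noteq> {}" by blast
  then have aff: "affine hull S = UNIV" by (rule affine_hull_nonempty_interior)
  have Seq: "S = affine hull S \<inter> \<Inter>(H ` I)" unfolding aff by (auto simp: S H_def)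
  have "F facet_of S \<longleftrightarrow> (\<exists>h. h \<in> H ` I \<and> F = S \<inter> {x. (a \<circ> g) h \<bullet> x = (b \<circ> g) h})" for F
  proof (rule facet_of_polyhedron_explicit)
    show "finite (H ` I)" using \<open>finite I\<close> by simp
    show "S = affine hull S \<inter> \<Inter>(H ` I)" by (fact Seq)
  next
    fix h assume "h \<in> H ` I"
    then obtain i where i: "i \<in> I" "h = H i" by auto
    obtain w where "b i < a i \<bullet> w" using irredundant[OF i(1)] by blast
    then have "a i \<noteq> 0" using strict[OF i(1)] by auto
    then show "(a \<circ> g) h \<noteq> 0 \<and> h = {x. (a \<circ> g) h \<bullet> x \<le> (b \<circ> g) h}"
      using i g by (simp add: H_def)
  next
    fix F' assume F': "F' \<subset> H ` I"
    then obtain i where i: "i \<in> I" "H i \<notin> F'" by auto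
    obtain w where w: "b i < a i \<bullet> w" "\<forall>j\<in>I - {i}. a j \<bullet> w \<le> b j" using irredundant[OF i(1)] by blast
    have "w \<notin> S" using w(1) i(1) by (auto simp: S not_le)
    moreover have "w \<in> \<Inter>F'"
    proof
      fix h assume "h \<in> F'"
      then obtain j where j: "j \<in> I" "h = H j" using F' by auto
      then have "j \<noteq> i" using i \<open>h \<in> F'\<close> by auto
      then show "w \<in> h" using w(2) j by (simp add: H_def)
    qed
    moreover have "S \<subseteq> affine hull S \<inter> \<Inter>F'" using Seq F' by blast
    ultimately show "S \<subset> affine hull S \<inter> \<Inter>F'" unfolding aff by auto
  qed
  then have "F facet_of S \<longleftrightarrow> (\<exists>i\<in>I. F = {x \<in> S. a i \<bullet> x = b i})" for F
    by (simp add: g Int_def)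
  then show "{F. F facet_of S} = (\<lambda>i. {x \<in> S. a i \<bullet> x = b i}) ` I"
    by blast
  show "inj_on (\<lambda>i. {x \<in> S. a i \<bullet> x = b i}) I"
  proof (rule inj_onI, rule ccontr)
    fix i j assume ij: "i \<in> I" "j \<in> I" "{x \<in> S. a i \<bullet> x = b i} = {x \<in> S. a j \<bullet> x = b j}" "i \<noteq> j"
    obtain w where w: "b i < a i \<bullet> w" "\<forall>j\<in>I - {i}. a j \<bullet> w \<le> b j" using irredundant[OF ij(1)] by blast
    \<comment> \<open>the point where the segment from \<open>z\<close> to \<open>w\<close> leaves the \<open>i\<close>-th halfspace\<close>
    define t where "t = (b i - a i \<bullet> z) / (a i \<bullet> w - a i \<bullet> z)"
    have t: "0 < t" "t < 1" using w(1) strict[OF ij(1)] by (auto simp: t_def)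
    define y where "y = (1 - t) *\<^sub>R z + t *\<^sub>R w"
    have yi: "a i \<bullet> y = b i"
    proof -
      have "a i \<bullet> y = a i \<bullet> z + t * (a i \<bullet> w - a i \<bullet> z)"
        by (simp add: y_def inner_add_right algebra_simps)
      then show ?thesis using w(1) strict[OF ij(1)] by (simp add: t_def)
    qed
    have yk: "a k \<bullet> y < b k" if "k \<in> I" "k \<noteq> i" for k
    proof -
      have "(1 - t) * (a k \<bullet> z) < (1 - t) * b k" using strict[OF that(1)] t by simp
      moreover have "t * (a k \<bullet> w) \<le> t * b k" using w(2) that t by simp
      ultimately show ?thesis by (simp add: y_def inner_add_right algebra_simps)
    qed
    have "a k \<bullet> y \<le> b k" if "k \<in> I" for k using yi yk[OF that] by (cases "k = i") auto
    then have "y \<in> S" by (simp add: S)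
    then have "y \<in> {x \<in> S. a j \<bullet> x = b j}" using yi ij(3) by auto
    then show False using yk[of j] ij by auto
  qed
qed

section \<open>Coordinates\<close>

lemma bij_betw_coord_index:
  "bij_betw (\<lambda>i. sorted_list_of_set (UNIV :: 'n::{finite,linorder} set) ! (i - 1)) {1..CARD('n)} UNIV"
proof -
  have 1: "bij_betw (\<lambda>i. i - 1) {1..CARD('n)} {..<CARD('n)}"
    by (rule bij_betw_byWitness[where f' = Suc]) auto
  have 2: "bij_betw ((!) (sorted_list_of_set (UNIV :: 'n set))) {..<CARD('n)} UNIV"
    by (rule bij_betw_nth) auto
  show ?thesis using bij_betw_trans[OF 1 2] by (simp add: o_def)
qed

lemma inner_eq_sum_coord:
  fixes x y :: "real ^ 'n::{finite,linorder}"
  shows "x \<bullet> y = (\<Sum>i=1..CARD('n). coord x i * coord y i)"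
  unfolding inner_vec_def inner_real_def coord_def
  by (rule sum.reindex_bij_betw[OF bij_betw_coord_index, symmetric])

lemma vec_eqI_coord:
  fixes x y :: "real ^ 'n::{finite,linorder}"
  assumes "\<And>i. 1 \<le> i \<Longrightarrow> i \<le> CARD('n) \<Longrightarrow> coord x i = coord y i"
  shows "x = y"
proof (rule vec_eq_iff[THEN iffD2], rule allI)
  fix j
  obtain i where "i \<in> {1..CARD('n)}" "j = sorted_list_of_set (UNIV :: 'n set) ! (i - 1)"
    using bij_betw_coord_index unfolding bij_betw_def by blast
  then show "x $ j = y $ j" using assms[of i] by (simp add: coord_def)
qed

lemma coord_linear [simp]:
  "coord (x + y) i = coord x i + coord y i"
  "coord (x - y) i = coord x i - coord y i"
  "coord (r *\<^sub>R x) i = r * coord x i"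
  by (simp_all add: coord_def)

text \<open>A right inverse of \<open>coord\<close> on the valid positions; only the values of
  \<open>f\<close> from 1 to the dimension enter.\<close>

definition of_coords :: "(nat \<Rightarrow> real) \<Rightarrow> real ^ 'n::{finite,linorder}" where
  "of_coords f = (\<chi> j. f (inv_into {1..CARD('n)}
     (\<lambda>i. sorted_list_of_set (UNIV :: 'n set) ! (i - 1)) j))"

lemma coord_of_coords [simp]:
  assumes "1 \<le> i" "i \<le> CARD('n)"
  shows "coord (of_coords f :: real ^ 'n::{finite,linorder}) i = f i"
  using assms bij_betw_inv_into_left[OF bij_betw_coord_index[where 'n = 'n], of i]
  by (simp add: of_coords_def coord_def)

section \<open>Degree partitions\<close>

text \<open>An edge at \<open>v\<close> is determined by its other endpoint. As a row sum of the
  adjacency matrix, the degree is open to double counting.\<close>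

lemma vertex_degree_eq_sum:
  assumes "simple_graph n E" "v \<in> {1..n}"
  shows "real (vertex_degree E v) = (\<Sum>u\<in>{1..n} - {v}. of_bool ({v, u} \<in> E))"
proof -
  have "{e \<in> E. v \<in> e} = (\<lambda>u. {v, u}) ` {u \<in> {1..n} - {v}. {v, u} \<in> E}" (is "?L = ?R")
  proof (intro equalityI subsetI)
    fix e assume e: "e \<in> ?L"
    then have "card e = 2" "e \<subseteq> {1..n}" using assms by (auto simp: simple_graph_def)
    then obtain a b where ab: "e = {a, b}" "a \<noteq> b" by (meson card_2_iff)
    then show "e \<in> ?R" using e \<open>e \<subseteq> {1..n}\<close> by (auto simp: insert_commute)
  qed auto
  moreover have "inj_on (\<lambda>u. {v, u}) {u \<in> {1..n} - {v}. {v, u} \<in> E}"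
    by (rule inj_onI) (auto simp: doubleton_eq_iff)
  ultimately have "vertex_degree E v = card {u \<in> {1..n} - {v}. {v, u} \<in> E}"
    by (simp add: vertex_degree_def card_image)
  also have "real \<dots> = (\<Sum>u\<in>{1..n} - {v}. of_bool ({v, u} \<in> E))"
    by (simp add: of_bool_def sum.If_cases Int_def)
  finally show ?thesis .
qed

lemma degree_partition_bij:
  obtains \<pi> where "bij_betw \<pi> {1..n} {1..n}"
    "\<And>i. i \<in> {1..n} \<Longrightarrow> degree_partition n E ! (i - 1) = vertex_degree E (\<pi> i)"
proof -
  have "degree_partition n E <~~> map (vertex_degree E) [1..<Suc n]"
    by (simp add: degree_partition_def)
  from permutation_Ex_bij[OF this] obtain f where
    f: "bij_betw f {..<n} {..<n}"
      "\<forall>i<n. degree_partition n E ! i = map (vertex_degree E) [1..<Suc n] ! f i"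
    by (auto simp: degree_partition_def simp del: upt_Suc)
  have 1: "bij_betw (\<lambda>i. i - 1) {1..n} {..<n}"
    by (rule bij_betw_byWitness[where f' = Suc]) auto
  have 2: "bij_betw Suc {..<n} {1..n}"
    by (rule bij_betw_byWitness[where f' = "\<lambda>i. i - 1"]) auto
  show ?thesis
  proof
    show "bij_betw (Suc \<circ> (f \<circ> (\<lambda>i. i - 1))) {1..n} {1..n}"
      using 1 2 f(1) bij_betw_trans by blast
  next
    fix i assume i: "i \<in> {1..n}"
    then have "f (i - 1) < n" using f(1) by (auto simp: bij_betw_def)
    then show "degree_partition n E ! (i - 1) = vertex_degree E ((Suc \<circ> (f \<circ> (\<lambda>i. i - 1))) i)"
      using f(2) i by (auto simp del: upt_Suc)
  qed
qed

lemma degree_partition_antimono: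
  assumes "1 \<le> i" "i \<le> j" "j \<le> n"
  shows "degree_partition n E ! (j - 1) \<le> degree_partition n E ! (i - 1)"
  by (rule sorted_rev_nth_mono) (use assms in \<open>auto simp: degree_partition_def\<close>)

text \<open>Sorting does nothing here. This serves the threshold graph, whose vertices are already
  numbered by weakly decreasing degree.\<close>

lemma degree_partition_nth_sorted:
  assumes "\<And>i j. 1 \<le> i \<Longrightarrow> i \<le> j \<Longrightarrow> j \<le> n \<Longrightarrow> vertex_degree E j \<le> vertex_degree E i"
    and "i \<in> {1..n}"
  shows "degree_partition n E ! (i - 1) = vertex_degree E i"
proof -
  let ?d = "map (vertex_degree E) [1..<Suc n]"
  have "sorted (rev ?d)"
    unfolding sorted_rev_iff_nth_mono using assms(1) by (auto simp del: upt_Suc)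
  then have "sort ?d = rev ?d" by (intro properties_for_sort) auto
  then have "degree_partition n E = ?d" by (simp add: degree_partition_def)
  then show ?thesis using assms(2) by (auto simp del: upt_Suc)
qed

text \<open>Each vertex of \<open>S\<close> has total weight at most
  \<open>card V - 1 - card T\<close> to vertices outside \<open>T\<close>; by symmetry, the weight
  between \<open>S\<close> and \<open>T\<close> is absorbed by the subtracted row sums over
  \<open>T\<close>.\<close>

lemma sum_degree_diff_le:
  fixes a :: "'v \<Rightarrow> 'v \<Rightarrow> real"
  assumes "finite V" "S \<subseteq> V" "T \<subseteq> V" "S \<inter> T = {}"
    and sym: "\<And>u v. a u v = a v u" and a01: "\<And>u v. 0 \<le> a u v" "\<And>u v. a u v \<le> 1"
  shows "(\<Sum>v\<in>S. \<Sum>u\<in>V - {v}. a v u) - (\<Sum>v\<in>T. \<Sum>u\<in>V - {v}. a v u)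
         \<le> real (card S) * (real (card V) - 1 - real (card T))"
proof -
  have fin: "finite S" "finite T" using assms(1-3) by (auto intro: finite_subset)
  have "(\<Sum>v\<in>S. \<Sum>u\<in>V - {v}. a v u) \<le> (\<Sum>v\<in>S. (real (card V) - 1 - real (card T)) + (\<Sum>u\<in>T. a v u))"
  proof (rule sum_mono)
    fix v assume v: "v \<in> S"
    have T: "T \<subseteq> V - {v}" using v assms by auto
    have vV: "v \<in> V" using v assms by auto
    have "(\<Sum>u\<in>V - {v}. a v u) = (\<Sum>u\<in>(V - {v}) - T. a v u) + (\<Sum>u\<in>T. a v u)"
      using T assms(1) by (intro sum.subset_diff) auto
    moreover have "(\<Sum>u\<in>(V - {v}) - T. a v u) \<le> real (card ((V - {v}) - T))"
      using sum_bounded_above[of "(V - {v}) - T" "a v" 1] a01 by simp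
    moreover have "real (card ((V - {v}) - T)) = real (card V) - 1 - real (card T)"
    proof -
      have "card ((V - {v}) - T) = card (V - {v}) - card T" by (rule card_Diff_subset[OF fin(2) T])
      moreover have "card T \<le> card (V - {v})" using T assms(1) by (intro card_mono) auto
      moreover have "card (V - {v}) = card V - 1" using vV by simp
      moreover have "card V \<ge> 1" using vV assms(1) by (metis card_gt_0_iff empty_iff less_eq_Suc_le One_nat_def)
      ultimately show ?thesis by linarith
    qed
    ultimately show "(\<Sum>u\<in>V - {v}. a v u) \<le> (real (card V) - 1 - real (card T)) + (\<Sum>u\<in>T. a v u)" by linarith
  qed
  also have "\<dots> = real (card S) * (real (card V) - 1 - real (card T)) + (\<Sum>v\<in>S. \<Sum>u\<in>T. a v u)"
    by (simp add: sum.distrib)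
  also have "(\<Sum>v\<in>S. \<Sum>u\<in>T. a v u) = (\<Sum>v\<in>T. \<Sum>u\<in>S. a v u)"
    by (subst sum.swap) (simp add: sym)
  also have "\<dots> \<le> (\<Sum>v\<in>T. \<Sum>u\<in>V - {v}. a v u)"
    by (intro sum_mono sum_mono2) (use assms in auto)
  finally show ?thesis by linarith
qed

text \<open>The edge count, applied to the vertices sorted into the first \<open>k\<close> and the
  last \<open>l\<close> positions; \<open>k + l \<le> n\<close> keeps these two sets
  disjoint.\<close>

lemma sum_degree_partition_diff_le:
  assumes E: "simple_graph n E" and kl: "k + l \<le> n"
  shows "(\<Sum>i=1..k. real (degree_partition n E ! (i - 1)))
           - (\<Sum>i=n - l + 1..n. real (degree_partition n E ! (i - 1))) \<le> kl_rhs n k l"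
proof -
  obtain \<pi> where bij: "bij_betw \<pi> {1..n} {1..n}"
    and \<pi>: "\<And>i. i \<in> {1..n} \<Longrightarrow> degree_partition n E ! (i - 1) = vertex_degree E (\<pi> i)"
    using degree_partition_bij by blast
  have inj: "inj_on \<pi> {1..n}" and img: "\<pi> ` {1..n} = {1..n}" using bij by (auto simp: bij_betw_def)
  have *: "(\<Sum>i\<in>I. real (degree_partition n E ! (i - 1)))
      = (\<Sum>v\<in>\<pi> ` I. \<Sum>u\<in>{1..n} - {v}. of_bool ({v, u} \<in> E))"
    and card: "card (\<pi> ` I) = card I" and sub: "\<pi> ` I \<subseteq> {1..n}" if I: "I \<subseteq> {1..n}" for I
  proof -
    have injI: "inj_on \<pi> I" using inj I by (rule inj_on_subset)
    show sub: "\<pi> ` I \<subseteq> {1..n}" using img I by blast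
    show "card (\<pi> ` I) = card I" using injI by (rule card_image)
    have "(\<Sum>i\<in>I. real (degree_partition n E ! (i - 1))) = (\<Sum>i\<in>I. real (vertex_degree E (\<pi> i)))"
      using I by (intro sum.cong refl) (metis \<pi> subsetD)
    also have "\<dots> = (\<Sum>v\<in>\<pi> ` I. real (vertex_degree E v))"
      using injI by (simp add: sum.reindex)
    also have "\<dots> = (\<Sum>v\<in>\<pi> ` I. \<Sum>u\<in>{1..n} - {v}. of_bool ({v, u} \<in> E))"
      using sub by (intro sum.cong refl vertex_degree_eq_sum[OF E]) auto
    finally show "(\<Sum>i\<in>I. real (degree_partition n E ! (i - 1)))
      = (\<Sum>v\<in>\<pi> ` I. \<Sum>u\<in>{1..n} - {v}. of_bool ({v, u} \<in> E))" .
  qed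
  have k: "{1..k} \<subseteq> {1..n}" and l: "{n - l + 1..n} \<subseteq> {1..n}" using kl by auto
  have "\<pi> ` {1..k} \<inter> \<pi> ` {n - l + 1..n} = \<pi> ` ({1..k} \<inter> {n - l + 1..n})"
    using inj_on_image_Int[OF inj k l] by simp
  also have "{1..k} \<inter> {n - l + 1..n} = {}" using kl by auto
  finally have disj: "\<pi> ` {1..k} \<inter> \<pi> ` {n - l + 1..n} = {}" by simp
  have "card {n - l + 1..n} = l" using kl by simp
  then show ?thesis
    using sum_degree_diff_le[of "{1..n}" "\<pi> ` {1..k}" "\<pi> ` {n - l + 1..n}" "\<lambda>v u. of_bool ({v, u} \<in> E)"]
      disj sub[OF k] sub[OF l] *[OF k] *[OF l] card[OF k] card[OF l]
    by (simp add: kl_rhs_def insert_commute)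
qed

section \<open>Threshold graphs and the hull of degree partitions\<close>

text \<open>Exchanging \<open>i\<close> and \<open>j\<close> shows that an off-diagonal double sum
  depends only on the symmetrization of its summand.\<close>

lemma sum_offdiag_symmetrize:
  fixes G H :: "'v \<Rightarrow> 'v \<Rightarrow> real"
  assumes "finite V" and GH: "\<And>i j. G i j + G j i = H i j + H j i"
  shows "(\<Sum>i\<in>V. \<Sum>j\<in>V - {i}. G i j) = (\<Sum>i\<in>V. \<Sum>j\<in>V - {i}. H i j)"
proof -
  have swap: "(\<Sum>i\<in>V. \<Sum>j\<in>V - {i}. F i j) = (\<Sum>i\<in>V. \<Sum>j\<in>V - {i}. F j i)" for F :: "'v \<Rightarrow> 'v \<Rightarrow> real"
  proof -
    have V: "V - {i} = {j \<in> V. i \<noteq> j}" "V - {i} = {j \<in> V. j \<noteq> i}" for i by auto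
    show ?thesis
      using sum.swap_restrict[OF assms(1) assms(1), of F "\<lambda>i j. i \<noteq> j"]
      unfolding V(1)[symmetric] V(2)[symmetric] by simp
  qed
  have double: "2 * (\<Sum>i\<in>V. \<Sum>j\<in>V - {i}. F i j) = (\<Sum>i\<in>V. \<Sum>j\<in>V - {i}. F i j + F j i)"
    for F :: "'v \<Rightarrow> 'v \<Rightarrow> real"
    using swap[of F] by (simp add: sum.distrib)
  show ?thesis using double[of G] double[of H] GH by simp
qed

text \<open>With its mirror image below, this turns the level sets of a decreasing sequence into the
  index ranges occurring in the inequalities (ii).\<close>

lemma downclosed_eq_atLeastAtMost:
  assumes "A \<subseteq> {1..n::nat}" and "\<And>i j. 1 \<le> i \<Longrightarrow> i \<le> j \<Longrightarrow> j \<in> A \<Longrightarrow> i \<in> A"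
  shows "A = {1..card A}"
proof (cases "A = {}")
  case False
  have fin: "finite A" using assms(1) by (rule finite_subset) simp
  have "A = {1..Max A}"
  proof (intro equalityI subsetI)
    fix i assume "i \<in> A"
    then show "i \<in> {1..Max A}" using assms(1) Max_ge[OF fin] by auto
  next
    fix i assume "i \<in> {1..Max A}"
    then show "i \<in> A" using assms(2)[OF _ _ Max_in[OF fin False]] by simp
  qed
  then show ?thesis by (metis card_atLeastAtMost diff_Suc_1)
qed simp

lemma upclosed_eq_atLeastAtMost:
  assumes "A \<subseteq> {1..n::nat}" and "\<And>i j. i \<in> A \<Longrightarrow> i \<le> j \<Longrightarrow> j \<le> n \<Longrightarrow> j \<in> A"
  shows "A = {n - card A + 1..n}"
proof (cases "A = {}")
  case False
  have fin: "finite A" using assms(1) by (rule finite_subset) simp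
  have A: "A = {Min A..n}"
  proof (intro equalityI subsetI)
    fix i assume "i \<in> A"
    then show "i \<in> {Min A..n}" using assms(1) Min_le[OF fin] by auto
  next
    fix i assume "i \<in> {Min A..n}"
    then show "i \<in> A" using assms(2)[OF Min_in[OF fin False]] by simp
  qed
  have "1 \<le> Min A" "Min A \<le> n" using Min_in[OF fin False] assms(1) by auto
  moreover have "card A = Suc n - Min A" using A by (metis card_atLeastAtMost)
  ultimately have "n - card A + 1 = Min A" by linarith
  then show ?thesis using A by simp
qed simp

text \<open>Layer-cake formula for the positive part of \<open>a\<close>; the maximum covers the
  empty interval for negative \<open>a\<close>.\<close>

lemma has_bochner_integral_atLeastLessThan:
  "has_bochner_integral lborel (indicator {0..<a} :: real \<Rightarrow> real) (max 0 a)"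
proof -
  have "emeasure lborel {0..<a} < \<infinity>" by (cases "0 \<le> a") auto
  then have "has_bochner_integral lborel (indicator {0..<a} :: real \<Rightarrow> real) (measure lborel {0..<a})"
    by (intro has_bochner_integral_real_indicator) auto
  then show ?thesis by (cases "0 \<le> a") (auto simp: max_def)
qed

lemma sum_mult_le_threshold:
  fixes c x :: "nat \<Rightarrow> real"
  assumes mono: "\<And>i j. 1 \<le> i \<Longrightarrow> i \<le> j \<Longrightarrow> j \<le> n \<Longrightarrow> c j \<le> c i"
    and kl: "\<And>k l. k + l \<le> n \<Longrightarrow> (\<Sum>i=1..k. x i) - (\<Sum>i=n - l + 1..n. x i) \<le> kl_rhs n k l"
  shows "(\<Sum>i=1..n. c i * x i) \<le> (\<Sum>i=1..n. c i * (\<Sum>j\<in>{1..n} - {i}. of_bool (0 < c i + c j)))"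
proof -
  define L where "L t = (\<Sum>i=1..n. (indicator {0..<c i} t - indicator {0..<- c i} t) * x i)" for t :: real
  \<comment> \<open>For \<open>0 \<le> t\<close> the summand is 1 if \<open>t < c i\<close> and not
    \<open>t < - c j\<close>, and 0 otherwise. So \<open>R t\<close> is the right-hand side of (ii)
    for the sizes of the two level sets, written as a sum over pairs.\<close>
  define R :: "real \<Rightarrow> real" where "R t = (\<Sum>i=1..n. \<Sum>j\<in>{1..n} - {i}.
      indicator {0..<c i} t - indicator {0..<min (c i) (- c j)} t)" for t
  have "has_bochner_integral lborel L (\<Sum>i=1..n. (max 0 (c i) - max 0 (- c i)) * x i)"
    unfolding L_def
    by (intro has_bochner_integral_sum has_bochner_integral_mult_left has_bochner_integral_diff
        has_bochner_integral_atLeastLessThan)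
  moreover have "max 0 a - max 0 (- a) = a" for a :: real by auto
  ultimately have L: "has_bochner_integral lborel L (\<Sum>i=1..n. c i * x i)" by simp
  have R: "has_bochner_integral lborel R (\<Sum>i=1..n. \<Sum>j\<in>{1..n} - {i}.
      max 0 (c i) - max 0 (min (c i) (- c j)))"
    unfolding R_def
    by (intro has_bochner_integral_sum has_bochner_integral_diff has_bochner_integral_atLeastLessThan)
  have LR: "L t \<le> R t" for t
  proof (cases "0 \<le> t")
    case True
    define S T where "S = {i \<in> {1..n}. t < c i}" and "T = {i \<in> {1..n}. t < - c i}"
    have fin: "finite S" "finite T" and sub: "S \<subseteq> {1..n}" "T \<subseteq> {1..n}" by (auto simp: S_def T_def)
    have disj: "S \<inter> T = {}" using True by (auto simp: S_def T_def)
    have S: "S = {1..card S}"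
      by (rule downclosed_eq_atLeastAtMost[where n = n])
        (use mono in \<open>force simp: S_def\<close>)+
    have T: "T = {n - card T + 1..n}"
      by (rule upclosed_eq_atLeastAtMost) (use mono in \<open>force simp: T_def\<close>)+
    have "card S + card T = card (S \<union> T)" using disj fin by (simp add: card_Un_disjoint)
    also have "\<dots> \<le> n" using card_mono[of "{1..n}" "S \<union> T"] sub by simp
    finally have le: "card S + card T \<le> n" .
    have ind: "indicator {0..<a} t = (of_bool (t < a) :: real)" for a
      using True by (simp add: indicator_def)
    have sum_of_bool: "(\<Sum>i=1..n. of_bool (P i) * f i) = (\<Sum>i\<in>{i \<in> {1..n}. P i}. f i)"
      for P and f :: "nat \<Rightarrow> real"
      by (simp add: Int_def)
    have "L t = (\<Sum>i\<in>S. x i) - (\<Sum>i\<in>T. x i)"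
      unfolding L_def ind S_def T_def left_diff_distrib sum_subtractf sum_of_bool ..
    also have "\<dots> \<le> kl_rhs n (card S) (card T)"
      using kl[OF le] S T by simp
    also have "\<dots> = (\<Sum>i\<in>S. real n - 1 - real (card T))"
      by (simp add: kl_rhs_def)
    also have "\<dots> = (\<Sum>i\<in>S. \<Sum>j\<in>{1..n} - {i}. 1 - of_bool (t < - c j))"
    proof (rule sum.cong[OF refl])
      fix i assume i: "i \<in> S"
      have "(\<Sum>j\<in>{1..n} - {i}. of_bool (t < - c j)) = real (card T)"
      proof -
        have "(\<Sum>j\<in>{1..n} - {i}. of_bool (t < - c j)) = real (card {j \<in> {1..n} - {i}. t < - c j})"
          by (simp add: of_bool_def sum.If_cases Int_def)
        also have "{j \<in> {1..n} - {i}. t < - c j} = T" using i True by (auto simp: T_def S_def)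
        finally show ?thesis .
      qed
      then show "real n - 1 - real (card T) = (\<Sum>j\<in>{1..n} - {i}. 1 - of_bool (t < - c j))"
        using i sub by (auto simp: sum_subtractf of_nat_diff)
    qed
    also have "\<dots> = (\<Sum>i=1..n. of_bool (t < c i) * (\<Sum>j\<in>{1..n} - {i}. 1 - of_bool (t < - c j)))"
      unfolding sum_of_bool S_def ..
    also have "\<dots> = R t"
      unfolding R_def ind sum_distrib_left by (intro sum.cong refl) auto
    finally show ?thesis .
  next
    case False
    then show ?thesis by (simp add: L_def R_def indicator_def)
  qed
  have "(\<Sum>i=1..n. c i * x i) = integral\<^sup>L lborel L"
    using L by (simp add: has_bochner_integral_integral_eq)
  also have "\<dots> \<le> integral\<^sup>L lborel R"
    using L R LR by (intro integral_mono) (auto simp: has_bochner_integral_iff)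
  also have "\<dots> = (\<Sum>i=1..n. \<Sum>j\<in>{1..n} - {i}. max 0 (c i) - max 0 (min (c i) (- c j)))"
    using R by (simp add: has_bochner_integral_integral_eq)
  \<comment> \<open>The summands differ individually, but adding the transpose turns both into
    \<open>max 0 (c i + c j)\<close>.\<close>
  also have "\<dots> = (\<Sum>i=1..n. \<Sum>j\<in>{1..n} - {i}. c i * of_bool (0 < c i + c j))"
    by (rule sum_offdiag_symmetrize) (auto simp: max_def min_def)
  finally show ?thesis by (simp only: sum_distrib_left)
qed

text \<open>Outside the pair, \<open>i\<close> is adjacent to everything \<open>j\<close> is
  adjacent to; the possible edge between \<open>i\<close> and \<open>j\<close> counts equally for
  both.\<close>

lemma threshold_degree_mono:
  fixes c :: "nat \<Rightarrow> real"
  assumes "finite V" "i \<in> V" "j \<in> V" "c j \<le> c i"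
  shows "(\<Sum>u\<in>V - {j}. of_bool (0 < c j + c u)) \<le> (\<Sum>u\<in>V - {i}. of_bool (0 < c i + c u) :: real)"
proof (cases "i = j")
  case False
  have Vj: "V - {j} - {i} = V - {i, j}" and Vi: "V - {i} - {j} = V - {i, j}" by auto
  have "(\<Sum>u\<in>V - {j}. of_bool (0 < c j + c u) :: real)
      = of_bool (0 < c j + c i) + (\<Sum>u\<in>V - {i, j}. of_bool (0 < c j + c u))"
    unfolding Vj[symmetric] by (rule sum.remove) (use assms False in auto)
  moreover have "(\<Sum>u\<in>V - {i}. of_bool (0 < c i + c u) :: real)
      = of_bool (0 < c i + c j) + (\<Sum>u\<in>V - {i, j}. of_bool (0 < c i + c u))"
    unfolding Vi[symmetric] by (rule sum.remove) (use assms False in auto)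
  moreover have "(\<Sum>u\<in>V - {i, j}. of_bool (0 < c j + c u)) \<le> (\<Sum>u\<in>V - {i, j}. of_bool (0 < c i + c u) :: real)"
    by (intro sum_mono) (use assms in auto)
  ultimately show ?thesis by (simp add: add.commute[of "c i" "c j"])
qed simp

lemma antimono_on_atLeastAtMost:
  fixes c :: "nat \<Rightarrow> real"
  assumes "\<And>i. i \<in> {1..n - 1} \<Longrightarrow> c (i + 1) \<le> c i" and "1 \<le> i" "i \<le> j" "j \<le> n"
  shows "c j \<le> c i"
  using assms(3,4)
proof (induction j rule: dec_induct)
  case (step m)
  then have "c (m + 1) \<le> c m" "c m \<le> c i" using assms(1)[of m] assms(2) by auto
  then show ?case by simp
qed simp

text \<open>Finiteness makes the convex hull compact, which strict separation requires.\<close>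

lemma finite_degree_vectors:
  "finite {x :: (real, 'n::{finite,linorder}) vec. \<exists>E. simple_graph CARD('n) E \<and>
     (\<forall>i\<in>{1..CARD('n)}. coord x i = real (degree_partition CARD('n) E ! (i - 1)))}"
proof (rule finite_subset)
  let ?f = "\<lambda>E. of_coords (\<lambda>i. real (degree_partition CARD('n) E ! (i - 1))) :: (real, 'n) vec"
  show "finite (?f ` Pow (Pow {1..CARD('n)}))" by simp
  show "{x. \<exists>E. simple_graph CARD('n) E \<and> (\<forall>i\<in>{1..CARD('n)}.
          coord x i = real (degree_partition CARD('n) E ! (i - 1)))} \<subseteq> ?f ` Pow (Pow {1..CARD('n)})"
  proof
    fix x :: "(real, 'n) vec"
    assume "x \<in> {x. \<exists>E. simple_graph CARD('n) E \<and> (\<forall>i\<in>{1..CARD('n)}.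
          coord x i = real (degree_partition CARD('n) E ! (i - 1)))}"
    then obtain E where E: "simple_graph CARD('n) E"
      "\<And>i. i \<in> {1..CARD('n)} \<Longrightarrow> coord x i = real (degree_partition CARD('n) E ! (i - 1))" by blast
    have "x = ?f E" by (rule vec_eqI_coord) (use E(2) in simp)
    moreover have "E \<in> Pow (Pow {1..CARD('n)})" using E(1) by (auto simp: simple_graph_def)
    ultimately show "x \<in> ?f ` Pow (Pow {1..CARD('n)})" by blast
  qed
qed

lemma mem_DP_if:
  fixes x :: "real ^ 'n::{finite,linorder}"
  assumes sorted: "\<And>i. i \<in> {1..CARD('n) - 1} \<Longrightarrow> coord x (i + 1) \<le> coord x i"
    and kl: "\<And>k l. k + l \<le> CARD('n) \<Longrightarrow> kl_lhs k l x \<le> kl_rhs CARD('n) k l"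
  shows "x \<in> DP"
proof (rule ccontr)
  assume "x \<notin> DP"
  let ?n = "CARD('n)"
  have "compact (DP :: (real, 'n) vec set)"
    unfolding DP_def by (rule finite_imp_compact_convex_hull[OF finite_degree_vectors])
  moreover have "convex (DP :: (real, 'n) vec set)" by (simp add: DP_def)
  ultimately obtain a :: "(real, 'n) vec" and b where a: "a \<bullet> x < b" "\<forall>y\<in>DP. b < a \<bullet> y"
    using separating_hyperplane_closed_point \<open>x \<notin> DP\<close> compact_imp_closed by metis
  define K where "K = {y :: (real, 'n) vec. \<forall>i\<in>{1..?n - 1}. coord y (i + 1) \<le> coord y i}"
  have "closed K"
    unfolding K_def Ball_def coord_def
    by (intro closed_Collect_all closed_Collect_imp open_Collect_const closed_Collect_le continuous_intros)
  moreover have "convex K"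
    unfolding convex_def K_def by (auto intro!: add_mono mult_left_mono)
  moreover have xK: "x \<in> K" using sorted by (simp add: K_def)
  \<comment> \<open>Moreau: \<open>c\<close> is the projection of the objective \<open>- a\<close> to the cone of decreasing vectors,
    so that \<open>- a - c\<close> is nonpositive on the cone and vanishes at \<open>c\<close>.\<close>
  define c where "c = closest_point K (- a)"
  ultimately have cK: "c \<in> K" and dot: "\<And>y. y \<in> K \<Longrightarrow> (- a - c) \<bullet> (y - c) \<le> 0"
    unfolding c_def using closest_point_in_set[of K] closest_point_dot[of K] xK by auto
  have cK': "coord c (i + 1) \<le> coord c i" if "i \<in> {1..?n - 1}" for i
    using cK that by (simp only: K_def mem_Collect_eq)
  have anti: "coord c j \<le> coord c i" if "1 \<le> i" "i \<le> j" "j \<le> ?n" for i j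
    by (rule antimono_on_atLeastAtMost[where c = "coord c", OF _ that]) (rule cK')
  define E where "E = {{i, j} | i j. i \<in> {1..?n} \<and> j \<in> {1..?n} \<and> i \<noteq> j \<and> 0 < coord c i + coord c j}"
  have E: "simple_graph ?n E" by (auto simp: simple_graph_def E_def)
  define D where "D i = (\<Sum>j\<in>{1..?n} - {i}. of_bool (0 < coord c i + coord c j) :: real)" for i
  have deg: "real (vertex_degree E i) = D i" if "i \<in> {1..?n}" for i
    unfolding vertex_degree_eq_sum[OF E that] D_def
    by (intro sum.cong refl) (use that in \<open>auto simp: E_def doubleton_eq_iff add.commute\<close>)
  have Dmono: "D j \<le> D i" if "i \<in> {1..?n}" "j \<in> {1..?n}" "coord c j \<le> coord c i" for i j
    unfolding D_def using that by (intro threshold_degree_mono) auto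
  define d :: "(real, 'n) vec" where "d = of_coords D"
  have d: "coord d i = D i" if "i \<in> {1..?n}" for i using that by (simp add: d_def)
  have "vertex_degree E j \<le> vertex_degree E i" if "1 \<le> i" "i \<le> j" "j \<le> ?n" for i j
    using Dmono[of i j] deg[of i] deg[of j] anti[OF that] that by simp
  then have "coord d i = real (degree_partition ?n E ! (i - 1))" if "i \<in> {1..?n}" for i
    using degree_partition_nth_sorted[of ?n E i] that deg d by auto
  then have "d \<in> DP" unfolding DP_def using E by (intro hull_inc) auto
  have "- a \<bullet> x \<le> c \<bullet> x"
  proof -
    \<comment> \<open>\<open>K\<close> is closed under addition, so \<open>c + x\<close> is a
      legitimate test point of the projection inequality, and \<open>c\<close> cancels.\<close>
    have "c + x \<in> K" using cK xK by (auto simp: K_def intro: add_mono)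
    from dot[OF this] show ?thesis by (simp add: inner_diff_left)
  qed
  also have "c \<bullet> x = (\<Sum>i=1..?n. coord c i * coord x i)" by (rule inner_eq_sum_coord)
  also have "\<dots> \<le> (\<Sum>i=1..?n. coord c i * D i)"
    unfolding D_def using anti kl by (intro sum_mult_le_threshold) (auto simp: kl_lhs_def)
  also have "\<dots> = c \<bullet> d" unfolding inner_eq_sum_coord using d by simp
  also have "c \<bullet> d \<le> - a \<bullet> d"
  proof -
    \<comment> \<open>\<open>d\<close> is constant on the blocks on which \<open>c\<close> is constant.\<close>
    have "\<forall>\<^sub>F \<epsilon> in at_right 0. coord c (i + 1) - \<epsilon> * D (i + 1) \<le> coord c i - \<epsilon> * D i"
      if i: "i \<in> {1..?n - 1}" for i
    proof (cases "coord c (i + 1) = coord c i")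
      case True
      then have "D (i + 1) = D i" using i by (intro antisym Dmono) auto
      then show ?thesis using True by simp
    next
      case False
      then have "0 < coord c i - coord c (i + 1)" using cK'[OF i] by simp
      moreover have "((\<lambda>\<epsilon>. (coord c i - \<epsilon> * D i) - (coord c (i + 1) - \<epsilon> * D (i + 1))) \<longlongrightarrow>
          (coord c i - 0 * D i) - (coord c (i + 1) - 0 * D (i + 1))) (at_right 0)"
        by (intro tendsto_intros)
      ultimately have "\<forall>\<^sub>F \<epsilon> in at_right 0. 0 < (coord c i - \<epsilon> * D i) - (coord c (i + 1) - \<epsilon> * D (i + 1))"
        by (intro order_tendstoD(1)) auto
      then show ?thesis by (rule eventually_mono) simp
    qed
    then have "\<forall>\<^sub>F \<epsilon> in at_right 0. \<forall>i\<in>{1..?n - 1}. coord c (i + 1) - \<epsilon> * D (i + 1) \<le> coord c i - \<epsilon> * D i"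
      by (intro eventually_ball_finite) auto
    moreover have "\<forall>\<^sub>F \<epsilon> in at_right (0 :: real). 0 < \<epsilon>" by (rule eventually_at_right_less)
    ultimately have "\<forall>\<^sub>F \<epsilon> in at_right (0 :: real). 0 < \<epsilon> \<and> c - \<epsilon> *\<^sub>R d \<in> K"
      by eventually_elim (auto simp: K_def d)
    then obtain \<epsilon> :: real where \<epsilon>: "0 < \<epsilon>" "c - \<epsilon> *\<^sub>R d \<in> K"
      using eventually_happens'[OF trivial_limit_at_right_real] by blast
    \<comment> \<open>The test point moves from \<open>c\<close> in direction \<open>- d\<close>, so
      the inequality comes out opposite to the one for \<open>x\<close>.\<close>
    from dot[OF \<epsilon>(2)] have "0 \<le> \<epsilon> * ((- a - c) \<bullet> d)" by simp
    then show ?thesis using \<epsilon>(1) by (simp add: zero_le_mult_iff inner_diff_left)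
  qed
  finally have "a \<bullet> d \<le> a \<bullet> x" by simp
  then show False using a \<open>d \<in> DP\<close> by force
qed

section \<open>Redundant inequalities\<close>

lemma sum_tail_Suc:
  fixes x :: "nat \<Rightarrow> real"
  assumes "l < n"
  shows "(\<Sum>i=n - Suc l + 1..n. x i) = x (n - l) + (\<Sum>i=n - l + 1..n. x i)"
proof -
  have "{n - Suc l + 1..n} = insert (n - l) {n - l + 1..n}" using assms by auto
  then show ?thesis by simp
qed

text \<open>The pairs \<open>(1, 0)\<close> and \<open>(0, 1)\<close> bound all entries between 0
  and \<open>n - 1\<close>, which settles \<open>l = 0\<close> and \<open>k = 0\<close>. For
  \<open>k + l = n - 2\<close>, use the pair \<open>(k + 1, l + 1)\<close> and drop the nonnegative
  \<open>x (k + 1) - x (k + 2)\<close>. For \<open>k + l = n - 1\<close>, average the pairs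
  \<open>(k + 1, l)\<close> and \<open>(k, l + 1)\<close>: the middle entry cancels.\<close>

lemma kl_le_if_KL:
  fixes x :: "nat \<Rightarrow> real"
  assumes n: "4 \<le> n"
    and sorted: "\<And>i. i \<in> {1..n - 1} \<Longrightarrow> x (i + 1) \<le> x i"
    and KL: "\<And>k l. (k, l) \<in> KL n \<Longrightarrow> (\<Sum>i=1..k. x i) - (\<Sum>i=n - l + 1..n. x i) \<le> kl_rhs n k l"
    and kl: "k + l \<le> n"
  shows "(\<Sum>i=1..k. x i) - (\<Sum>i=n - l + 1..n. x i) \<le> kl_rhs n k l"
proof -
  have anti: "x j \<le> x i" if "1 \<le> i" "i \<le> j" "j \<le> n" for i j
    using antimono_on_atLeastAtMost[of n x, OF sorted that] .
  have "x 1 \<le> real n - 1" using KL[of 1 0] by (simp add: KL_def kl_rhs_def)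
  have "0 \<le> x n" using KL[of 0 1] n by (simp add: KL_def kl_rhs_def)
  consider "k = 0" | "l = 0" | "(k, l) \<in> KL n" | "1 \<le> k" "1 \<le> l" "k + l = n - 2"
    | "1 \<le> k" "1 \<le> l" "k + l = n - 1"
    using kl unfolding KL_def by fastforce
  then show ?thesis
  proof cases
    case 1
    have "0 \<le> (\<Sum>i=n - l + 1..n. x i)"
    proof (rule sum_nonneg)
      fix i assume "i \<in> {n - l + 1..n}"
      then show "0 \<le> x i" using anti[of i n] \<open>0 \<le> x n\<close> by auto
    qed
    then show ?thesis using 1 by (simp add: kl_rhs_def)
  next
    case 2
    have "(\<Sum>i=1..k. x i) \<le> of_nat (card {1..k}) * (real n - 1)"
    proof (rule sum_bounded_above)
      fix i assume "i \<in> {1..k}"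
      then show "x i \<le> real n - 1" using anti[of 1 i] \<open>x 1 \<le> real n - 1\<close> kl by auto
    qed
    then show ?thesis using 2 by (simp add: kl_rhs_def)
  next
    case 3
    then show ?thesis by (rule KL)
  next
    case 4
    then have nl: "n - l = k + 2" and rn: "real n = real k + real l + 2" using n by auto
    have "(\<Sum>i=1..Suc k. x i) - (\<Sum>i=n - Suc l + 1..n. x i) \<le> kl_rhs n (Suc k) (Suc l)"
      using 4 n by (intro KL) (auto simp: KL_def)
    moreover have "x (k + 2) \<le> x (Suc k)" using anti[of "Suc k" "k + 2"] 4 n by simp
    ultimately show ?thesis
      unfolding sum_tail_Suc[of l n x] using 4 n sum_tail_Suc[of l n x] nl
      by (simp add: kl_rhs_def rn algebra_simps)
  next
    case 5
    then have nl: "n - l = Suc k" and rn: "real n = real k + real l + 1" using n by auto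
    have "(\<Sum>i=1..Suc k. x i) - (\<Sum>i=n - l + 1..n. x i) \<le> kl_rhs n (Suc k) l"
      using 5 n by (intro KL) (auto simp: KL_def)
    moreover have "(\<Sum>i=1..k. x i) - (\<Sum>i=n - Suc l + 1..n. x i) \<le> kl_rhs n k (Suc l)"
      using 5 n by (intro KL) (auto simp: KL_def)
    ultimately show ?thesis
      using 5 n sum_tail_Suc[of l n x] nl
      by (simp add: kl_rhs_def rn algebra_simps)
  qed
qed

section \<open>Points violating a single inequality\<close>

text \<open>With \<open>s = k + l\<close> the claim reduces to
  \<open>4 * k * l < s * (2 * n - 3)\<close>, which follows from
  \<open>4 * k * l \<le> s * s\<close> and \<open>s \<le> n\<close>. The room of 1/4 serves the
  strictly feasible point and the violators of (i).\<close>

lemma kl_strict_near_constant: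
  fixes w :: "nat \<Rightarrow> real"
  assumes n: "4 \<le> n" and w: "\<And>i. i \<in> {1..n} \<Longrightarrow> \<bar>w i - (real n - 1) / 2\<bar> \<le> 1 / 4"
    and kl: "(k, l) \<in> KL n"
  shows "(\<Sum>i=1..k. w i) - (\<Sum>i=n - l + 1..n. w i) < kl_rhs n k l"
proof -
  have s: "1 \<le> k + l" "k + l \<le> n" using kl n by (auto simp: KL_def)
  have bounds: "w i \<le> (real n - 1) / 2 + 1 / 4" "(real n - 1) / 2 - 1 / 4 \<le> w i" if "i \<in> {1..n}" for i
    using w[OF that] by linarith+
  have "(\<Sum>i=1..k. w i) \<le> of_nat (card {1..k}) * ((real n - 1) / 2 + 1 / 4)"
  proof (rule sum_bounded_above)
    fix i assume "i \<in> {1..k}"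
    then show "w i \<le> (real n - 1) / 2 + 1 / 4" using bounds(1)[of i] s by simp
  qed
  moreover have "of_nat (card {n - l + 1..n}) * ((real n - 1) / 2 - 1 / 4) \<le> (\<Sum>i=n - l + 1..n. w i)"
  proof (rule sum_bounded_below)
    fix i assume "i \<in> {n - l + 1..n}"
    then show "(real n - 1) / 2 - 1 / 4 \<le> w i" using bounds(2)[of i] by simp
  qed
  moreover have "card {n - l + 1..n} = l" using s by simp
  moreover have "real k * ((real n - 1) / 2 + 1 / 4) - real l * ((real n - 1) / 2 - 1 / 4)
      < real k * (real n - 1 - real l)"
  proof -
    define s where "s = real k + real l"
    have "0 < s * (2 * real n - 3 - s)"
      using s n by (intro mult_pos_pos) (auto simp: s_def)
    moreover have "4 * (real k * real l) \<le> s * s"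
      unfolding s_def using zero_le_square[of "real k - real l"] by (simp add: algebra_simps)
    ultimately show ?thesis unfolding s_def by (simp add: field_simps)
  qed
  ultimately show ?thesis by (simp add: kl_rhs_def)
qed

text \<open>For the inequality indexed by \<open>(p, q)\<close>, consider graphs in which the first \<open>p\<close> vertices form
  a clique, the last \<open>q\<close> vertices are independent, and the \<open>m\<close> vertices in between are joined to
  every vertex of the clique and to no vertex of the independent set. \<open>split_seq\<close> lists the expected
  degrees when the edges left open are present with probability \<open>1/2\<close>.\<close>

definition split_seq :: "nat \<Rightarrow> nat \<Rightarrow> nat \<Rightarrow> nat \<Rightarrow> real" where
  "split_seq p q m i =
     (if i \<le> p then real p - 1 + real m + real q / 2
      else if i \<le> p + m then real p + (real m - 1) / 2
      else real p / 2)"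

text \<open>Twice the shortfall of the first \<open>k\<close> entries of \<open>split_seq\<close>
  from \<open>n - 1\<close> each, doubled to stay integral. Truncated subtraction makes a block
  contribute 0 until \<open>k\<close> reaches it.\<close>

definition split_defect :: "nat \<Rightarrow> nat \<Rightarrow> nat \<Rightarrow> nat \<Rightarrow> int" where
  "split_defect p q m k = int q * int (min k p)
     + (2 * int q + int m - 1) * int (min (k - p) m)
     + (int p + 2 * int q + 2 * int m - 2) * int (k - p - m)"

lemma sum_split_seq:
  assumes "n = p + m + q"
  shows "(\<Sum>i=1..k. split_seq p q m i) = real k * (real n - 1) - of_int (split_defect p q m k) / 2"
proof (induction k)
  case (Suc k)
  have "of_int (split_defect p q m (Suc k)) - of_int (split_defect p q m k)
      = 2 * (real n - 1 - split_seq p q m (Suc k))"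
  proof -
    consider "k < p" | "p \<le> k" "k < p + m" | "p + m \<le> k" by linarith
    then show ?thesis
    proof cases
      case 1
      then show ?thesis using assms
        by (simp add: split_defect_def split_seq_def min_def algebra_simps)
    next
      case 2
      then obtain a where "k = p + a" "a < m" by (metis le_iff_add nat_add_left_cancel_less)
      then show ?thesis using assms
        by (simp add: split_defect_def split_seq_def min_def field_simps)
    next
      case 3
      then obtain a where "k = p + m + a" by (metis le_iff_add)
      then show ?thesis using assms
        by (simp add: split_defect_def split_seq_def min_def algebra_simps)
    qed
  qed
  then show ?case using Suc by (simp add: algebra_simps)
qed (simp add: split_defect_def)

text \<open>Complementing the graph exchanges the clique and the independent set and reverses the
  order of degrees.\<close>

lemma split_seq_reverse:
  assumes "n = p + m + q" "i \<in> {1..n}"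
  shows "split_seq p q m (n + 1 - i) = real n - 1 - split_seq q p m i"
  using assms by (auto simp: split_seq_def field_simps)

lemma sum_tail_split_seq:
  assumes n: "n = p + m + q" and "l \<le> n"
  shows "(\<Sum>i=n - l + 1..n. split_seq p q m i) = of_int (split_defect q p m l) / 2"
proof -
  have "(\<Sum>i=n - l + 1..n. split_seq p q m i) = (\<Sum>i=1..l. split_seq p q m (n + 1 - i))"
    by (rule sum.reindex_bij_witness[where i = "\<lambda>i. n + 1 - i" and j = "\<lambda>i. n + 1 - i"])
      (use assms in auto)
  also have "\<dots> = (\<Sum>i=1..l. real n - 1 - split_seq q p m i)"
    using assms by (intro sum.cong refl split_seq_reverse) auto
  also have "\<dots> = of_int (split_defect q p m l) / 2"
    using sum_split_seq[of n q m p l] n by (simp add: sum_subtractf)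
  finally show ?thesis .
qed

text \<open>The right-hand side is twice the slack of \<open>(k, l)\<close> at
  \<open>split_seq p q m\<close>. Being an integer, it only has to be shown positive, by expanding
  it according to the blocks in which the two ranges end.\<close>

lemma split_defect_ge:
  assumes n: "4 \<le> n" and pq: "(p, q) \<in> KL n" and nm: "n = p + m + q"
    and kl: "(k, l) \<in> KL n" and ne: "(k, l) \<noteq> (p, q)"
  shows "1 \<le> split_defect p q m k + split_defect q p m l - 2 * int k * int l"
proof -
  \<comment> \<open>This is where the sums \<open>n - 1\<close> and \<open>n - 2\<close> being
    excluded from \<open>KL n\<close> matters.\<close>
  have m: "m = 0 \<or> 3 \<le> m" using pq nm n by (auto simp: KL_def)
  \<comment> \<open>The head overruns the clique. The disjunction lets this also serve the mirrored
    case, with both pairs swapped.\<close>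
  have left: "1 \<le> split_defect p q m k + split_defect q p m l - 2 * int k * int l"
    if pq: "(p, q) \<in> KL n \<or> (q, p) \<in> KL n" and nm: "n = p + m + q"
      and k: "p < k" "l \<le> q" "k + l \<le> n" for p q k l
  proof (cases "k \<le> p + m")
    case True
    then obtain a where a: "k = p + a" "1 \<le> a" "a \<le> m" using True k by (intro that[of "k - p"]) auto
    obtain b where b: "q = l + b" using k by (metis le_iff_add)
    have "split_defect p q m k + split_defect q p m l - 2 * int k * int l
        = int p * int b + 2 * int a * int b + int a * (int m - 1)"
      using a b by (simp add: split_defect_def min_def algebra_simps)
    moreover have "1 * 1 \<le> int a * (int m - 1)" using a m by (intro mult_mono) auto
    moreover have "0 \<le> int p * int b + 2 * int a * int b" by simp
    ultimately show ?thesis by linarith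
  next
    case False
    then obtain c where c: "k = p + m + c" "1 \<le> c" by (intro that[of "k - p - m"]) auto
    obtain b where b: "q = l + c + b" using k c nm by (intro that[of "q - l - c"]) auto
    have "split_defect p q m k + split_defect q p m l - 2 * int k * int l
        = int p * int (c + b) + 2 * int m * int (c + b) + int m * (int m - 1)
          + int c * (int p + 2 * int m + 2 * int c + 2 * int b - 2)"
      using b c by (simp add: split_defect_def min_def algebra_simps)
    moreover have "0 \<le> 2 * int m * int (c + b)" by simp
    moreover have "1 \<le> int p * int (c + b) + int m * (int m - 1)"
    proof (cases "p = 0")
      case True
      \<comment> \<open>\<open>p = 0\<close> forces \<open>q = 1\<close>, hence
        \<open>m = n - 1\<close>.\<close>
      then have "3 \<le> m" using pq nm n m by (auto simp: KL_def)
      then have "1 * 1 \<le> int m * (int m - 1)" by (intro mult_mono) auto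
      then show ?thesis using True by simp
    next
      case False
      then have "1 * 1 \<le> int p * int (c + b)" using c by (intro mult_mono) auto
      moreover have "0 \<le> int m * (int m - 1)" using m by auto
      ultimately show ?thesis by linarith
    qed
    moreover have "0 \<le> int c * (int p + 2 * int m + 2 * int c + 2 * int b - 2)" using c by simp
    ultimately show ?thesis by linarith
  qed
  have s: "k + l \<le> n" using kl n by (auto simp: KL_def)
  consider "k \<le> p" "l \<le> q" | "p < k" "l \<le> q" | "k \<le> p" "q < l" | "p < k" "q < l" by linarith
  then show ?thesis
  proof cases
    case 1
    then obtain d e where d: "p = k + d" "q = l + e" by (metis le_iff_add)
    have "split_defect p q m k + split_defect q p m l - 2 * int k * int l = int (k * e + l * d)"
      using d by (simp add: split_defect_def min_def algebra_simps)
    \<comment> \<open>If \<open>k\<close> and \<open>l\<close> are positive, zero would force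
      \<open>d = e = 0\<close>. Otherwise one of them is 0 and the other 1, and zero would force
      \<open>(p, q)\<close> to be the same special pair.\<close>
    moreover have "k * e + l * d \<noteq> 0"
      using pq kl ne d n by (auto simp: KL_def)
    ultimately show ?thesis by linarith
  next
    case 2
    then show ?thesis using left[of p q k l] pq nm s by simp
  next
    case 3
    then show ?thesis using left[of q p l k] pq nm s by (simp add: add.commute mult.commute mult.left_commute)
  next
    case 4
    then obtain a b where ab: "k = p + a" "l = q + b" "1 \<le> a" "1 \<le> b"
      by (metis less_imp_add_positive less_eq_Suc_le One_nat_def)
    then have abm: "a + b \<le> m" and m3: "3 \<le> m" using s nm m by auto
    have "split_defect p q m k + split_defect q p m l - 2 * int k * int l
        = (int a + int b) * (int m - 1) - 2 * int a * int b"
      using ab abm by (simp add: split_defect_def min_def algebra_simps)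
    \<comment> \<open>Since \<open>a + b \<le> m\<close>, the left-over is at least
      \<open>a * (a - 1) + b * (b - 1)\<close>, which vanishes only at \<open>a = b = 1\<close>;
      there \<open>3 \<le> m\<close> is decisive.\<close>
    moreover have "1 \<le> (int a + int b) * (int m - 1) - 2 * int a * int b"
    proof (cases "a = 1 \<and> b = 1")
      case True
      then show ?thesis using m3 by simp
    next
      case False
      have "(int a + int b) * (int a + int b - 1) \<le> (int a + int b) * (int m - 1)"
        using abm by (intro mult_left_mono) auto
      moreover have "0 \<le> int a * (int a - 1)" "0 \<le> int b * (int b - 1)" using ab by auto
      moreover have "int a * (int a - 1) \<noteq> 0 \<or> int b * (int b - 1) \<noteq> 0" using ab False by auto
      moreover have "(int a + int b) * (int a + int b - 1) - 2 * int a * int b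
          = int a * (int a - 1) + int b * (int b - 1)" by (simp add: algebra_simps)
      ultimately show ?thesis by linarith
    qed
    ultimately show ?thesis by simp
  qed
qed

text \<open>The perturbation of \<open>split_seq\<close> violates the inequality \<open>(p, q)\<close>, and only this one since all
  others have slack at least \<open>1/2\<close>. If \<open>p = 0\<close> or \<open>q = 0\<close> then \<open>x / 0 = 0\<close> is harmless, as the
  corresponding branch is never reached.\<close>

lemma kl_violator:
  assumes n: "4 \<le> n" and pq: "(p, q) \<in> KL n"
  obtains w :: "nat \<Rightarrow> real" where
    "\<And>i. i \<in> {1..n - 1} \<Longrightarrow> w (i + 1) \<le> w i"
    "kl_rhs n p q < (\<Sum>i=1..p. w i) - (\<Sum>i=n - q + 1..n. w i)"
    "\<And>k l. (k, l) \<in> KL n \<Longrightarrow> (k, l) \<noteq> (p, q) \<Longrightarrow>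
       (\<Sum>i=1..k. w i) - (\<Sum>i=n - l + 1..n. w i) \<le> kl_rhs n k l"
proof
  define m where "m = n - p - q"
  have le: "p + q \<le> n" and pos: "1 \<le> p + q" using pq n by (auto simp: KL_def)
  then have nm: "n = p + m + q" by (simp add: m_def)
  \<comment> \<open>The shifts total 1/4 over a nonempty clique and -1/4 over a nonempty independent
    set, so no left-hand side grows by more than 1/2.\<close>
  define \<delta> :: "nat \<Rightarrow> real" where
    "\<delta> i = (if i \<le> p then 1 / (4 * real p) else if i \<le> p + m then 0 else - 1 / (4 * real q))" for i
  define w where "w i = split_seq p q m i + \<delta> i" for i
  have \<delta>1: "(\<Sum>i=1..p. \<delta> i) = (if p = 0 then 0 else 1 / 4)"
    by (auto simp: \<delta>_def)
  have \<delta>2: "(\<Sum>i=n - q + 1..n. \<delta> i) = (if q = 0 then 0 else - 1 / 4)"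
  proof -
    have "(\<Sum>i=n - q + 1..n. \<delta> i) = (\<Sum>i=n - q + 1..n. - 1 / (4 * real q))"
      using nm by (intro sum.cong) (auto simp: \<delta>_def)
    then show ?thesis using le by simp
  qed
  have \<delta>k: "(\<Sum>i=1..k. \<delta> i) \<le> 1 / 4" for k
  proof -
    have "(\<Sum>i=1..k. \<delta> i) \<le> (\<Sum>i\<in>{1..k} \<inter> {1..p}. 1 / (4 * real p))"
      by (subst sum.inter_restrict) (auto simp: \<delta>_def intro!: sum_mono)
    also have "\<dots> \<le> real p * (1 / (4 * real p))"
      using card_mono[of "{1..p}" "{1..k} \<inter> {1..p}"] by (simp add: divide_right_mono)
    also have "\<dots> \<le> 1 / 4" by simp
    finally show ?thesis .
  qed
  have \<delta>l: "- 1 / 4 \<le> (\<Sum>i=n - l + 1..n. \<delta> i)" for l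
  proof -
    have "- (\<Sum>i=n - l + 1..n. \<delta> i) = (\<Sum>i=n - l + 1..n. - \<delta> i)" by (simp add: sum_negf)
    also have "\<dots> \<le> (\<Sum>i\<in>{n - l + 1..n} \<inter> {p + m + 1..n}. 1 / (4 * real q))"
      by (subst sum.inter_restrict) (auto simp: \<delta>_def intro!: sum_mono)
    also have "\<dots> = real (card ({n - l + 1..n} \<inter> {p + m + 1..n})) * (1 / (4 * real q))" by simp
    also have "\<dots> \<le> real q * (1 / (4 * real q))"
    proof -
      have "card ({n - l + 1..n} \<inter> {p + m + 1..n}) \<le> card {p + m + 1..n}" by (rule card_mono) auto
      also have "\<dots> = q" using nm by simp
      finally show ?thesis by (intro mult_right_mono) auto
    qed
    also have "\<dots> \<le> 1 / 4" by simp
    finally show ?thesis by simp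
  qed
  have lhs: "(\<Sum>i=1..k. w i) - (\<Sum>i=n - l + 1..n. w i) = kl_rhs n k l
      - of_int (split_defect p q m k + split_defect q p m l - 2 * int k * int l) / 2
      + (\<Sum>i=1..k. \<delta> i) - (\<Sum>i=n - l + 1..n. \<delta> i)" if "l \<le> n" for k l
    unfolding w_def sum.distrib sum_split_seq[OF nm] sum_tail_split_seq[OF nm that]
    by (simp add: kl_rhs_def field_simps)
  show "w (i + 1) \<le> w i" if i: "i \<in> {1..n - 1}" for i
  proof -
    have "split_seq p q m (i + 1) \<le> split_seq p q m i"
      using pos nm i by (auto simp: split_seq_def field_simps)
    moreover have "\<delta> (i + 1) \<le> \<delta> i"
      by (auto simp: \<delta>_def intro: order_trans[of _ "0 :: real"])
    ultimately show ?thesis by (simp add: w_def)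
  qed
  \<comment> \<open>The inequality \<open>(p, q)\<close> is tight before the perturbation.\<close>
  have "split_defect p q m p + split_defect q p m q - 2 * int p * int q = 0"
    by (simp add: split_defect_def)
  then show "kl_rhs n p q < (\<Sum>i=1..p. w i) - (\<Sum>i=n - q + 1..n. w i)"
    using lhs[of q p] \<delta>1 \<delta>2 pos le by auto
  show "(\<Sum>i=1..k. w i) - (\<Sum>i=n - l + 1..n. w i) \<le> kl_rhs n k l"
    if kl: "(k, l) \<in> KL n" "(k, l) \<noteq> (p, q)" for k l
  proof -
    have "l \<le> n" using kl n by (auto simp: KL_def)
    define s where "s = split_defect p q m k + split_defect q p m l - 2 * int k * int l"
    have "1 \<le> real_of_int s" using split_defect_ge[OF n pq nm kl] unfolding s_def by linarith
    then show ?thesis using lhs[OF \<open>l \<le> n\<close>, of k, folded s_def] \<delta>k[of k] \<delta>l[of l] by linarith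
  qed
qed

section \<open>Counting the inequalities (ii)\<close>

lemma finite_KL: "finite (KL n)"
  by (rule finite_subset[of _ "{..n + 1} \<times> {..n + 1}"]) (auto simp: KL_def)

text \<open>Apart from the two special pairs, \<open>KL n\<close> is a disjoint union of
  antidiagonals \<open>k + l = s\<close>, each with \<open>s - 1\<close> points.\<close>

lemma card_KL:
  assumes "4 \<le> n"
  shows "real (card (KL n)) = real n + 1 + (real n - 3) * (real n - 4) / 2"
proof -
  let ?S = "\<lambda>s. {(k, l). 1 \<le> k \<and> 1 \<le> l \<and> k + l = s}"
  have S: "?S s = (\<lambda>k. (k, s - k)) ` {1..s - 1}" for s :: nat by auto
  have fin: "finite (?S s)" for s :: nat unfolding S by simp
  have cardS: "card (?S s) = s - 1" for s :: nat
    unfolding S by (subst card_image) (auto simp: inj_on_def)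
  have KL: "KL n = {(1, 0), (0, 1)} \<union> ((\<Union>s\<in>{2..n - 3}. ?S s) \<union> ?S n)"
    by (auto simp: KL_def)
  have "card (\<Union>s\<in>{2..n - 3}. ?S s) = (\<Sum>s\<in>{2..n - 3}. s - 1)"
    unfolding cardS[symmetric] by (rule card_UN_disjoint) (use fin in auto)
  moreover have "card ((\<Union>s\<in>{2..n - 3}. ?S s) \<union> ?S n) = card (\<Union>s\<in>{2..n - 3}. ?S s) + card (?S n)"
    by (rule card_Un_disjoint) (use fin assms in auto)
  moreover have "card (KL n) = card {(1, 0), (0, 1 :: nat) :: nat \<times> nat}
      + card ((\<Union>s\<in>{2..n - 3}. ?S s) \<union> ?S n)"
    unfolding KL by (rule card_Un_disjoint) (use fin in auto)
  ultimately have c: "card (KL n) = 2 + (\<Sum>s\<in>{2..n - 3}. s - 1) + (n - 1)" using cardS by simp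
  obtain j where j: "n = j + 4" using assms by (metis add.commute le_iff_add)
  have "real (\<Sum>s\<in>{2..j + 1}. s - 1) = (real j + 1) * real j / 2"
  proof (induction j)
    case (Suc j)
    have "{2..Suc j + 1} = insert (j + 2) {2..j + 1}" by auto
    then show ?case using Suc by (simp add: field_simps)
  qed simp
  then show ?thesis unfolding c using j by (simp add: field_simps)
qed

section \<open>The facets\<close>

theorem theorem5p2:
  fixes n :: nat and P :: "(real ^ 'n::{finite,linorder}) set"
  assumes "n = CARD('n)" and "n \<ge> 4" and "P = DP"
  shows "(\<forall>x\<in>P. (\<forall>i\<in>{1..n - 1}. coord x i \<ge> coord x (i + 1)) \<and>
                 (\<forall>(k, l)\<in>KL n. kl_lhs k l x \<le> kl_rhs n k l)) \<and>
         {F. F facet_of P} =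
           (\<lambda>i. {x \<in> P. coord x i = coord x (i + 1)}) ` {1..n - 1} \<union>
           (\<lambda>(k, l). {x \<in> P. kl_lhs k l x = kl_rhs n k l}) ` KL n \<and>
         real (card {F. F facet_of P}) = real n * (real n - 3) / 2 + 6"
proof -
  note n = \<open>n = CARD('n)\<close> and n4 = \<open>n \<ge> 4\<close>
  \<comment> \<open>The sum type merges both families into one system of upper bounds:
    \<open>Inl\<close> indexes (i), \<open>Inr\<close> indexes (ii).\<close>
  define a :: "nat + nat \<times> nat \<Rightarrow> (real, 'n) vec" where
    "a = case_sum (\<lambda>i. of_coords (\<lambda>j. of_bool (j = i + 1) - of_bool (j = i)))
           (\<lambda>(k, l). of_coords (\<lambda>j. of_bool (j \<in> {1..k}) - of_bool (j \<in> {n - l + 1..n})))"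
  define b :: "nat + nat \<times> nat \<Rightarrow> real" where "b = case_sum (\<lambda>i. 0) (\<lambda>(k, l). kl_rhs n k l)"
  define I where "I = Inl ` {1..n - 1} \<union> Inr ` KL n"
  have le: "k \<le> n" "l \<le> n" if "(k, l) \<in> KL n" for k l
    using that n4 by (auto simp: KL_def)
  have sum_of_bool: "(\<Sum>j=1..n. of_bool (j \<in> A) * f j) = (\<Sum>j\<in>A. f j)" if "A \<subseteq> {1..n}" for A and f :: "nat \<Rightarrow> real"
    using that by (simp add: Int_absorb1)
  have inner_of_coords: "of_coords f \<bullet> x = (\<Sum>j=1..n. f j * coord x j)"
    for f and x :: "(real, 'n) vec"
    unfolding inner_eq_sum_coord n by (intro sum.cong) auto
  have aInl: "a (Inl i) \<bullet> x = coord x (i + 1) - coord x i" if i: "i \<in> {1..n - 1}" for i x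
  proof -
    have "a (Inl i) \<bullet> x = (\<Sum>j=1..n. of_bool (j \<in> {i + 1}) * coord x j) - (\<Sum>j=1..n. of_bool (j \<in> {i}) * coord x j)"
      by (simp add: a_def inner_of_coords left_diff_distrib sum_subtractf)
    also have "\<dots> = (\<Sum>j\<in>{i + 1}. coord x j) - (\<Sum>j\<in>{i}. coord x j)"
      by (intro arg_cong2[where f = "(-)"] sum_of_bool) (use i n4 in auto)
    finally show ?thesis by simp
  qed
  have aInr: "a (Inr (k, l)) \<bullet> x = kl_lhs k l x" if kl: "(k, l) \<in> KL n" for k l x
  proof -
    have "a (Inr (k, l)) \<bullet> x = (\<Sum>j=1..n. of_bool (j \<in> {1..k}) * coord x j)
        - (\<Sum>j=1..n. of_bool (j \<in> {n - l + 1..n}) * coord x j)"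
      unfolding a_def by (simp only: sum.case prod.case inner_of_coords left_diff_distrib sum_subtractf)
    also have "\<dots> = kl_lhs k l x"
      unfolding kl_lhs_def n[symmetric]
      by (intro arg_cong2[where f = "(-)"] sum_of_bool) (use le[OF kl] in auto)
    finally show ?thesis .
  qed
  have ball_I: "(\<forall>h\<in>I. a h \<bullet> x \<le> b h) \<longleftrightarrow>
      (\<forall>i\<in>{1..n - 1}. coord x (i + 1) \<le> coord x i) \<and> (\<forall>(k, l)\<in>KL n. kl_lhs k l x \<le> kl_rhs n k l)" for x
    unfolding I_def ball_Un ball_simps using aInl aInr by (auto simp: b_def)
  have kl_lhs_of_coords: "kl_lhs k l (of_coords w :: (real, 'n) vec) = (\<Sum>i=1..k. w i) - (\<Sum>i=n - l + 1..n. w i)"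
    if "(k, l) \<in> KL n" for k l w
    unfolding kl_lhs_def n[symmetric]
    by (intro arg_cong2[where f = "(-)"] sum.cong refl coord_of_coords) (use le[OF that] n in auto)
  have coord_of_coords': "coord (of_coords f :: (real, 'n) vec) i = f i"
    "coord (of_coords f :: (real, 'n) vec) (i + 1) = f (i + 1)" if "i \<in> {1..n - 1}" for f i
    by (rule coord_of_coords; use that n n4 in auto)+
  have P_system: "P = {x. \<forall>h\<in>I. a h \<bullet> x \<le> b h}"
  proof (intro equalityI subsetI)
    fix x assume "x \<in> P"
    \<comment> \<open>By convexity, the inequalities need checking only at the degree vectors that
      generate the hull.\<close>
    have "convex (\<Inter>h\<in>I. {x. a h \<bullet> x \<le> b h})"
      by (intro convex_INT convex_halfspace_le)
    then have "convex {x. \<forall>h\<in>I. a h \<bullet> x \<le> b h}"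
      by (simp add: Collect_ball_eq)
    moreover have "x \<in> {x. \<forall>h\<in>I. a h \<bullet> x \<le> b h}"
      if E: "simple_graph n E" and x: "\<And>i. i \<in> {1..n} \<Longrightarrow> coord x i = real (degree_partition n E ! (i - 1))"
      for x :: "(real, 'n) vec" and E
    proof -
      have "coord x (i + 1) \<le> coord x i" if "i \<in> {1..n - 1}" for i
        using x[of i] x[of "i + 1"] degree_partition_antimono[of i "i + 1" n E] that by auto
      moreover have "kl_lhs k l x \<le> kl_rhs n k l" if kl: "(k, l) \<in> KL n" for k l
      proof -
        have "kl_lhs k l x = (\<Sum>i=1..k. real (degree_partition n E ! (i - 1)))
           - (\<Sum>i=n - l + 1..n. real (degree_partition n E ! (i - 1)))"
          unfolding kl_lhs_def n[symmetric]
          by (intro arg_cong2[where f = "(-)"] sum.cong refl x) (use le[OF kl] in auto)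
        also have "\<dots> \<le> kl_rhs n k l"
          using kl n4 by (intro sum_degree_partition_diff_le[OF E]) (auto simp: KL_def)
        finally show ?thesis .
      qed
      ultimately show ?thesis using ball_I by blast
    qed
    ultimately have "DP \<subseteq> {x. \<forall>h\<in>I. a h \<bullet> x \<le> b h}"
      unfolding DP_def n[symmetric] by (intro hull_minimal) blast+
    then show "x \<in> {x. \<forall>h\<in>I. a h \<bullet> x \<le> b h}" using \<open>x \<in> P\<close> \<open>P = DP\<close> by blast
  next
    fix x assume "x \<in> {x. \<forall>h\<in>I. a h \<bullet> x \<le> b h}"
    then have x: "\<And>i. i \<in> {1..n - 1} \<Longrightarrow> coord x (i + 1) \<le> coord x i"
      "\<And>k l. (k, l) \<in> KL n \<Longrightarrow> kl_lhs k l x \<le> kl_rhs n k l" using ball_I by blast+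
    have "kl_lhs k l x \<le> kl_rhs n k l" if "k + l \<le> n" for k l
      using kl_le_if_KL[OF n4 x(1) x(2)[unfolded kl_lhs_def n[symmetric]] that]
      unfolding kl_lhs_def n[symmetric] .
    then show "x \<in> P" unfolding \<open>P = DP\<close> using x(1) n by (intro mem_DP_if) auto
  qed
  have "finite I" by (simp add: I_def finite_KL)
  \<comment> \<open>The slope makes (i) strict while every entry stays within 1/4 of
    \<open>(n - 1) / 2\<close>, so (ii) is strict too.\<close>
  define z :: "(real, 'n) vec" where "z = of_coords (\<lambda>i. (real n - 1) / 2 - real i / (4 * real n))"
  have strict: "a h \<bullet> z < b h" if "h \<in> I" for h
    using that[unfolded I_def]
  proof (elim UnE imageE)
    fix i assume i: "h = Inl i" "i \<in> {1..n - 1}"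
    have "coord z (i + 1) < coord z i"
      unfolding z_def coord_of_coords'[OF i(2)] using n4 by (simp add: divide_strict_right_mono)
    then show ?thesis using i aInl[OF i(2)] by (simp add: b_def)
  next
    fix kl assume kl: "h = Inr kl" "kl \<in> KL n"
    obtain k l where "kl = (k, l)" by fastforce
    moreover have "kl_lhs k l z < kl_rhs n k l" if "(k, l) \<in> KL n"
      unfolding z_def kl_lhs_of_coords[OF that]
      by (rule kl_strict_near_constant[OF n4 _ that]) (auto simp: field_simps)
    ultimately show ?thesis using kl aInr by (simp add: b_def)
  qed
  have irredundant: "\<exists>w. b h < a h \<bullet> w \<and> (\<forall>h'\<in>I - {h}. a h' \<bullet> w \<le> b h')" if "h \<in> I" for h
    using that[unfolded I_def]
  proof (elim UnE imageE)
    fix i assume i: "h = Inl i" "i \<in> {1..n - 1}"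
    \<comment> \<open>The only ascent of \<open>f\<close> is from \<open>i\<close> to
      \<open>i + 1\<close>; the raised entries before \<open>i\<close> keep the step down to
      \<open>i\<close> legal.\<close>
    define f :: "nat \<Rightarrow> real" where "f j = (real n - 1) / 2 + (if j < i \<or> j = i + 1 then 1 / 4 else 0)" for j
    define w :: "(real, 'n) vec" where "w = of_coords f"
    have w1: "coord w (j + 1) \<le> coord w j" if "j \<in> {1..n - 1}" "j \<noteq> i" for j
      unfolding w_def coord_of_coords'[OF that(1)] using that by (simp add: f_def)
    have w2: "coord w i < coord w (i + 1)"
      unfolding w_def coord_of_coords'[OF i(2)] by (simp add: f_def)
    have w3: "kl_lhs k l w < kl_rhs n k l" if "(k, l) \<in> KL n" for k l
      unfolding w_def kl_lhs_of_coords[OF that]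
      by (rule kl_strict_near_constant[OF n4 _ that]) (auto simp: f_def)
    have "a h' \<bullet> w \<le> b h'" if "h' \<in> I - {h}" for h'
    proof (cases h')
      case (Inl j)
      then have "j \<in> {1..n - 1}" "j \<noteq> i" using that i(1) by (auto simp: I_def)
      then show ?thesis using aInl[of j w] w1[of j] Inl by (simp add: b_def)
    next
      case (Inr kl)
      then show ?thesis using that w3 by (auto simp: I_def b_def aInr less_imp_le)
    qed
    then show ?thesis using i aInl w2 by (intro exI[of _ w]) (auto simp: b_def)
  next
    fix pq assume pq: "h = Inr pq" "pq \<in> KL n"
    obtain p q where [simp]: "pq = (p, q)" by fastforce
    obtain f :: "nat \<Rightarrow> real" where f: "\<And>i. i \<in> {1..n - 1} \<Longrightarrow> f (i + 1) \<le> f i"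
      "kl_rhs n p q < (\<Sum>i=1..p. f i) - (\<Sum>i=n - q + 1..n. f i)"
      "\<And>k l. (k, l) \<in> KL n \<Longrightarrow> (k, l) \<noteq> (p, q) \<Longrightarrow>
         (\<Sum>i=1..k. f i) - (\<Sum>i=n - l + 1..n. f i) \<le> kl_rhs n k l"
      using kl_violator[OF n4, of p q] pq(2) by auto
    define w :: "(real, 'n) vec" where "w = of_coords f"
    have w1: "coord w (j + 1) \<le> coord w j" if "j \<in> {1..n - 1}" for j
      unfolding w_def coord_of_coords'[OF that] by (rule f(1)[OF that])
    have w2: "kl_rhs n p q < kl_lhs p q w"
      using f(2) kl_lhs_of_coords pq(2) by (simp add: w_def)
    have w3: "kl_lhs k l w \<le> kl_rhs n k l" if "(k, l) \<in> KL n" "(k, l) \<noteq> (p, q)" for k l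
      using f(3)[OF that] kl_lhs_of_coords[OF that(1)] by (simp add: w_def)
    have "a h' \<bullet> w \<le> b h'" if "h' \<in> I - {h}" for h'
    proof (cases h')
      case (Inl j)
      then show ?thesis using that w1[of j] by (auto simp: I_def b_def aInl)
    next
      case (Inr kl)
      then obtain k l where h': "h' = Inr (k, l)" by (cases kl) auto
      then have kl: "(k, l) \<in> KL n" "(k, l) \<noteq> (p, q)" using that pq(1) by (auto simp: I_def)
      show ?thesis using w3[OF kl] aInr[OF kl(1)] h' by (simp add: b_def)
    qed
    then show ?thesis using pq aInr w2 by (intro exI[of _ w]) (auto simp: b_def)
  qed
  have facets: "{F. F facet_of P} = (\<lambda>h. {x \<in> P. a h \<bullet> x = b h}) ` I"
    by (rule facets_irredundant_system[OF \<open>finite I\<close> P_system]) (fact strict, fact irredundant)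
  have inj: "inj_on (\<lambda>h. {x \<in> P. a h \<bullet> x = b h}) I"
    by (rule inj_on_irredundant_system[OF \<open>finite I\<close> P_system]) (fact strict, fact irredundant)
  have "{F. F facet_of P} =
           (\<lambda>i. {x \<in> P. coord x i = coord x (i + 1)}) ` {1..n - 1} \<union>
           (\<lambda>(k, l). {x \<in> P. kl_lhs k l x = kl_rhs n k l}) ` KL n"
    unfolding facets I_def image_Un image_image
    by (intro arg_cong2[where f = "(\<union>)"] image_cong refl) (use aInl aInr in \<open>auto simp: b_def\<close>)
  moreover have "real (card {F. F facet_of P}) = real n * (real n - 3) / 2 + 6"
  proof -
    have "card {F. F facet_of P} = card I" unfolding facets by (rule card_image[OF inj])
    also have "card I = (n - 1) + card (KL n)"
      unfolding I_def by (subst card_Un_disjoint) (auto simp: card_image finite_KL)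
    finally show ?thesis using card_KL[OF n4] n4 by (simp add: of_nat_diff field_simps)
  qed
  moreover have "\<forall>x\<in>P. (\<forall>i\<in>{1..n - 1}. coord x i \<ge> coord x (i + 1)) \<and>
                 (\<forall>(k, l)\<in>KL n. kl_lhs k l x \<le> kl_rhs n k l)"
    using P_system ball_I by blast
  ultimately show ?thesis by blast
qed

end
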